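(* Assume that for every fixed $e\in V$ the function $\tilde\psi:\Omega\to V$, defined by $\tilde\psi_\omega := R_\omega T_\omega e/\|R_\omega T_\omega e\|$ if $R_\omega T_\omega e\neq 0$ and $\tilde\psi_\omega:=0$ if $R_\omega T_\omega e=0$, is Bochner-measurable. If the solution $u$ of the variational problem $a(u,v)=F(v)$ for all $v\in V$ belongs to the linear space $A_2$, then the iterates $u^{(m)}$ of the incremental approximation algorithm described in the context satisfy, with $\delta_m^2:=\|u-u^{(m)}\|^2$, $$\mathbb{E}(\delta_m^2)\le \frac{(\Lambda\|u\|_{A_2}+\|u\|)^2}{m+1},\qquad m=0,1,2,\ldots.$$
   Context: Setting. $V$ is a separable real Hilbert space, $a(\cdot,\cdot)$ is a continuous, coercive, symmetric bilinear form on $V$; $V$ is equipped with the (equivalent) scalar product $a(\cdot,\cdot)$ and norm $\|v\|=a(v,v)^{1/2}$. $F$ is a bounded linear functional on $V$ and $u\in V$ is the unique element with $a(u,v)=F(v)$ for all $v\in V$. $\Omega$ is an index set (possibly uncountable) equipped with a probability measure $\rho$. For each $\omega\in\Omega$, $V_\omega$ is a separable real Hilbert space equipped with a (spectrally equivalent) scalar product $a_\omega(\cdot,\cdot)$ and norm $\|v_\omega\|_\omega=a_\omega(v_\omega,v_\omega)^{1/2}$, and $R_\omega:V_\omega\to V$ is a linear operator with $\mathrm{Ker}(R_\omega)=\{0\}$ such that, for a constant $\Lambda<\infty$ independent of $\omega$, $\|R_\omega\|_{V_\omega\to V}=\sup_{\|v_\omega\|_\omega=1}\|R_\omega v_\omega\|\le\Lambda$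 for all $\omega\in\Omega$. The linear operator $T_\omega:V\to V_\omega$ is defined by $a_\omega(T_\omega v,v_\omega)=a(v,R_\omega v_\omega)$ for all $v_\omega\in V_\omega$. Algorithm. Let $\omega_0,\omega_1,\ldots$ be independent samples from $\Omega$, identically distributed according to $\rho$. Set $u^{(0)}=0$ and, for $m=0,1,\ldots$, $$u^{(m+1)}=\alpha_m u^{(m)}+\xi_m R_{\omega_m}r^{(m)}_{\omega_m},\qquad r^{(m)}_{\omega_m}=T_{\omega_m}(u-u^{(m)}),\qquad \alpha_m=1-\frac{1}{m+2},$$ where $\xi_m\in\mathbb{R}$ minimizes $\xi\mapsto\|u-\alpha_m u^{(m)}-\xi R_{\omega_m}r^{(m)}_{\omega_m}\|^2$ (if $R_{\omega_m}r^{(m)}_{\omega_m}=0$ the value of $\xi_m$ is irrelevant). Thus $u^{(m)}$ and $\delta_m^2$ are random variables on $\Omega^m$ equipped with the product measure $\rho^m$, and $\mathbb{E}$ denotes expectation with respect to it. The class $A_2$. An element $u\in V$ belongs to $A_2$ if there are $v_\omega\in V_\omega$, $\omega\in\Omega$, such that $\omega\mapsto R_\omega v_\omega\in V$ is Bochner-measurable, the scalar function $\omega\mapsto\|v_\omega\|_\omega$ is measurable, and $$u=\int_\Omega R_\omega v_\omega\,d\rho_\omega\ \text{ (Bochner integral)},\qquad \int_\Omega\|v_\omega\|_\omega^2\,d\rho_\omega<\infty.$$ The norm is $\|u\|_{A_2}:=\inf\left(\int_\Omega\|v_\omega\|_\omega^2\,d\rho_\omega\right)^{1/2}$, the infimum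 being taken over all such representations of $u$. *)

theory Defs
  imports "HOL-Probability.Probability"
begin

text \<open>
  A family of Hilbert spaces \<open>V\<^sub>\<omega>\<close> depending on \<open>\<omega>\<close> cannot be a family of types. The \<open>V\<^sub>\<omega>\<close> are modelled as linear
  subspaces \<open>W \<omega>\<close> of one real vector space without topology; this is no restriction, since every
  family of vector spaces embeds into its algebraic direct sum. All metric structure of \<open>W \<omega>\<close> comes
  from a scalar product given on \<open>W \<omega>\<close> only.
\<close>

definition scalar_product_on :: "'w::real_vector set \<Rightarrow> ('w \<Rightarrow> 'w \<Rightarrow> real) \<Rightarrow> bool" where
  "scalar_product_on S B \<longleftrightarrow>
     (\<forall>x\<in>S. \<forall>y\<in>S. B x y = B y x) \<and>
     (\<forall>x\<in>S. \<forall>y\<in>S. \<forall>z\<in>S. B (x + y) z = B x z + B y z) \<and>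
     (\<forall>c. \<forall>x\<in>S. \<forall>y\<in>S. B (c *\<^sub>R x) y = c * B x y) \<and>
     (\<forall>x\<in>S. x \<noteq> 0 \<longrightarrow> 0 < B x x)"

definition form_norm :: "('w \<Rightarrow> 'w \<Rightarrow> real) \<Rightarrow> 'w \<Rightarrow> real" where
  "form_norm B x = sqrt (B x x)"

text \<open>
  The locale \<^locale>\<open>Metric_space\<close> requires symmetry and nonnegativity of the distance on the whole
  type, whence the value 0 outside of the carrier.
\<close>

definition form_dist :: "'w::real_vector set \<Rightarrow> ('w \<Rightarrow> 'w \<Rightarrow> real) \<Rightarrow> 'w \<Rightarrow> 'w \<Rightarrow> real" where
  "form_dist S B x y = (if x \<in> S \<and> y \<in> S then form_norm B (x - y) else 0)"

definition separable_hilbert_on :: "'w::real_vector set \<Rightarrow> ('w \<Rightarrow> 'w \<Rightarrow> real) \<Rightarrow> bool" where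
  "separable_hilbert_on S B \<longleftrightarrow>
     subspace S \<and> scalar_product_on S B \<and>
     Metric_space.mcomplete S (form_dist S B) \<and>
     separable_space (Metric_space.mtopology S (form_dist S B))"

definition spectrally_equivalent_on ::
    "'w set \<Rightarrow> ('w \<Rightarrow> 'w \<Rightarrow> real) \<Rightarrow> ('w \<Rightarrow> 'w \<Rightarrow> real) \<Rightarrow> bool" where
  "spectrally_equivalent_on S B C \<longleftrightarrow>
     (\<exists>k>0. \<exists>K. \<forall>x\<in>S. k * B x x \<le> C x x \<and> C x x \<le> K * B x x)"

definition linear_on_subspace :: "'w::real_vector set \<Rightarrow> ('w \<Rightarrow> 'v::real_vector) \<Rightarrow> bool" where
  "linear_on_subspace S R \<longleftrightarrow>
     (\<forall>x\<in>S. \<forall>y\<in>S. R (x + y) = R x + R y) \<and> (\<forall>c. \<forall>x\<in>S. R (c *\<^sub>R x) = c *\<^sub>R R x)"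

text \<open>Extended real valued, so that an unbounded operator has norm \<open>\<infinity>\<close>.\<close>

definition operator_norm_on ::
    "'w set \<Rightarrow> ('w \<Rightarrow> 'w \<Rightarrow> real) \<Rightarrow> ('v \<Rightarrow> 'v \<Rightarrow> real) \<Rightarrow> ('w \<Rightarrow> 'v) \<Rightarrow> ereal" where
  "operator_norm_on S B a R = (SUP x\<in>{x \<in> S. form_norm B x = 1}. ereal (form_norm a (R x)))"

text \<open>
  In a second countable Banach space, Bochner (strong) measurability is Borel measurability.
\<close>

definition A2_representation ::
    "'i measure \<Rightarrow> ('i \<Rightarrow> 'w set) \<Rightarrow> ('i \<Rightarrow> 'w \<Rightarrow> 'w \<Rightarrow> real) \<Rightarrow>
     ('i \<Rightarrow> 'w \<Rightarrow> 'v::{banach,second_countable_topology}) \<Rightarrow> 'v \<Rightarrow> ('i \<Rightarrow> 'w) \<Rightarrow> bool" where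
  "A2_representation \<rho> W b R u v \<longleftrightarrow>
     (\<forall>\<omega>\<in>space \<rho>. v \<omega> \<in> W \<omega>) \<and>
     (\<lambda>\<omega>. R \<omega> (v \<omega>)) \<in> borel_measurable \<rho> \<and>
     (\<lambda>\<omega>. form_norm (b \<omega>) (v \<omega>)) \<in> borel_measurable \<rho> \<and>
     has_bochner_integral \<rho> (\<lambda>\<omega>. R \<omega> (v \<omega>)) u \<and>
     integrable \<rho> (\<lambda>\<omega>. (form_norm (b \<omega>) (v \<omega>))\<^sup>2)"

definition A2 ::
    "'i measure \<Rightarrow> ('i \<Rightarrow> 'w set) \<Rightarrow> ('i \<Rightarrow> 'w \<Rightarrow> 'w \<Rightarrow> real) \<Rightarrow>
     ('i \<Rightarrow> 'w \<Rightarrow> 'v::{banach,second_countable_topology}) \<Rightarrow> 'v set" where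
  "A2 \<rho> W b R = {u. \<exists>v. A2_representation \<rho> W b R u v}"

definition A2_norm ::
    "'i measure \<Rightarrow> ('i \<Rightarrow> 'w set) \<Rightarrow> ('i \<Rightarrow> 'w \<Rightarrow> 'w \<Rightarrow> real) \<Rightarrow>
     ('i \<Rightarrow> 'w \<Rightarrow> 'v::{banach,second_countable_topology}) \<Rightarrow> 'v \<Rightarrow> real" where
  "A2_norm \<rho> W b R u =
     Inf {sqrt (\<integral>\<omega>. (form_norm (b \<omega>) (v \<omega>))\<^sup>2 \<partial>\<rho>) | v. A2_representation \<rho> W b R u v}"

definition relaxation :: "nat \<Rightarrow> real" where
  "relaxation m = 1 - 1 / (real m + 2)"

text \<open>
  \<open>s\<close> is the sequence of samples; the iterate with index \<open>m\<close> only depends on \<open>s 0, \<dots>, s (m - 1)\<close>.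
  If the search direction \<open>d\<close> vanishes, every \<open>\<xi>\<close> is a minimizer and its choice does not affect
  the next iterate; otherwise the minimizer is unique.
\<close>

primrec iterate ::
    "('v \<Rightarrow> 'v \<Rightarrow> real) \<Rightarrow> ('i \<Rightarrow> 'w \<Rightarrow> 'v::real_vector) \<Rightarrow> ('i \<Rightarrow> 'v \<Rightarrow> 'w) \<Rightarrow> 'v \<Rightarrow>
     (nat \<Rightarrow> 'i) \<Rightarrow> nat \<Rightarrow> 'v" where
  "iterate a R T u s 0 = 0"
| "iterate a R T u s (Suc m) =
     (let w = iterate a R T u s m;
          r = T (s m) (u - w);
          d = R (s m) r;
          \<xi> = arg_min (\<lambda>\<xi>::real. (form_norm a (u - relaxation m *\<^sub>R w - \<xi> *\<^sub>R d))\<^sup>2) (\<lambda>_. True)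
      in relaxation m *\<^sub>R w + \<xi> *\<^sub>R d)"

definition normalized_direction ::
    "('v \<Rightarrow> 'v \<Rightarrow> real) \<Rightarrow> ('i \<Rightarrow> 'w \<Rightarrow> 'v::real_vector) \<Rightarrow> ('i \<Rightarrow> 'v \<Rightarrow> 'w) \<Rightarrow> 'v \<Rightarrow> 'i \<Rightarrow> 'v" where
  "normalized_direction a R T e \<omega> =
     (if R \<omega> (T \<omega> e) \<noteq> 0 then R \<omega> (T \<omega> e) /\<^sub>R form_norm a (R \<omega> (T \<omega> e)) else 0)"

end

theory Submission
  imports Defs
begin

text \<open>
  Write \<open>e\<close> for the error after \<open>m\<close> steps, \<open>\<psi>\<close> for the normalized search direction that the next
  sample assigns to \<open>e\<close>, and \<open>\<alpha> = 1 - \<beta>\<close> for the relaxation parameter. The line search makes the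
  next error the distance of \<open>\<alpha> e + \<beta> u\<close> from the span of \<open>\<psi>\<close> (\<open>error_step\<close>). Comparing it
  with a step of length \<open>\<beta> \<Lambda> \<parallel>v \<omega>\<parallel>\<close>, where \<open>v\<close> is any square integrable representation of \<open>u\<close>,
  bounds the squared next error by
  \<open>\<alpha>\<^sup>2 \<parallel>e\<parallel>\<^sup>2 + 2 \<alpha> \<beta> (a e u - \<Lambda> \<parallel>v \<omega>\<parallel> a e \<psi>) + \<beta>\<^sup>2 (\<Lambda> \<parallel>v \<omega>\<parallel> + \<parallel>u\<parallel>)\<^sup>2\<close>.

  The mixed term has nonpositive mean (\<open>correlation_bound\<close>): the adjoint relation turns \<open>a e u\<close> into
  the mean of the local scalar products of \<open>T \<omega> e\<close> and \<open>v \<omega>\<close>, and the norm of \<open>T \<omega> e\<close> is at most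
  \<open>\<Lambda> a e \<psi>\<close>. In the last term the mean of \<open>\<parallel>v \<omega>\<parallel>\<close> is at most its quadratic mean. This gives
  \<open>E \<delta>\<^sub>m\<^sub>+\<^sub>1\<^sup>2 \<le> \<alpha>\<^sup>2 E \<delta>\<^sub>m\<^sup>2 + \<beta>\<^sup>2 C\<close> with \<open>C\<close> the square of \<open>\<Lambda>\<close> times the quadratic mean plus
  \<open>\<parallel>u\<parallel>\<close>. For \<open>\<beta> = 1 / (m + 2)\<close> the rate \<open>C / (m + 1)\<close> follows by induction, and the infimum over
  all representations brings in the norm of \<open>A2\<close>.

  Integrating over one sample at a time needs a further argument, since directions are assumed to be
  measurable in the sample only for a fixed vector, while the error depends on earlier samples. The
  directions are nevertheless jointly measurable in vector and sample
  (\<open>direction_jointly_measurable\<close>), because \<open>R \<omega> \<circ> T \<omega>\<close> is continuous and self-adjoint.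
\<close>

section \<open>Scalar products on a subspace\<close>

context
  fixes S :: "'w::real_vector set" and B :: "'w \<Rightarrow> 'w \<Rightarrow> real"
  assumes subspace: "subspace S" and scalar_product: "scalar_product_on S B"
begin

lemmas scalar_product_laws = scalar_product[unfolded scalar_product_on_def]

lemmas scalar_product_sym = scalar_product_laws[THEN conjunct1, rule_format]

lemmas scalar_product_add = scalar_product_laws[THEN conjunct2, THEN conjunct1, rule_format]

lemmas scalar_product_scaleR =
  scalar_product_laws[THEN conjunct2, THEN conjunct2, THEN conjunct1, rule_format]

lemmas scalar_product_pos =
  scalar_product_laws[THEN conjunct2, THEN conjunct2, THEN conjunct2, rule_format]

lemma scalar_product_zero: "x \<in> S \<Longrightarrow> B 0 x = 0"
  using scalar_product_scaleR[of x x 0] by simp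

lemma scalar_product_nonneg: "x \<in> S \<Longrightarrow> 0 \<le> B x x"
  using scalar_product_zero[of x] scalar_product_pos[of x] by (cases "x = 0") auto

lemma form_norm_power2: "x \<in> S \<Longrightarrow> (form_norm B x)\<^sup>2 = B x x"
  by (simp add: form_norm_def scalar_product_nonneg)

lemma scalar_product_eq_zero: "x \<in> S \<Longrightarrow> B x x = 0 \<Longrightarrow> x = 0"
  using scalar_product_pos[of x] by force

lemma form_norm_scaleR: "x \<in> S \<Longrightarrow> form_norm B (c *\<^sub>R x) = \<bar>c\<bar> * form_norm B x"
proof -
  assume x: "x \<in> S"
  have cx: "c *\<^sub>R x \<in> S" by (rule subspace_scale[OF subspace x])
  have "B (c *\<^sub>R x) (c *\<^sub>R x) = c\<^sup>2 * B x x"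
    using scalar_product_scaleR[OF x cx] scalar_product_scaleR[OF x x] scalar_product_sym[OF x cx]
    by (simp add: power2_eq_square)
  then show ?thesis
    by (simp add: form_norm_def real_sqrt_mult)
qed

lemma scalar_product_quadratic:
  assumes x: "x \<in> S" and y: "y \<in> S"
  shows "B (x - t *\<^sub>R y) (x - t *\<^sub>R y) = B x x - 2 * t * B x y + t\<^sup>2 * B y y"
proof -
  define w where "w = (- t) *\<^sub>R y"
  have w: "w \<in> S" unfolding w_def by (rule subspace_scale[OF subspace y])
  have xw: "x + w \<in> S" by (rule subspace_add[OF subspace x w])
  have Bw: "B w z = - t * B y z" if "z \<in> S" for z
    unfolding w_def by (rule scalar_product_scaleR[OF y that])
  have "B (x + w) (x + w) = B x (x + w) + B w (x + w)"
    by (rule scalar_product_add[OF x w xw])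
  also have "\<dots> = B (x + w) x + B (x + w) w"
    using scalar_product_sym[OF x xw] scalar_product_sym[OF w xw] by simp
  also have "\<dots> = B x x + 2 * B w x + B w w"
    using scalar_product_add[OF x w x] scalar_product_add[OF x w w] scalar_product_sym[OF x w] by simp
  also have "\<dots> = B x x - 2 * t * B x y + t\<^sup>2 * B y y"
    using Bw[OF x] Bw[OF w] scalar_product_sym[OF y w] Bw[OF y] scalar_product_sym[OF x y]
    by (simp add: power2_eq_square)
  finally show ?thesis by (simp add: w_def)
qed

lemma scalar_product_Cauchy_Schwarz:
  assumes x: "x \<in> S" and y: "y \<in> S"
  shows "\<bar>B x y\<bar> \<le> form_norm B x * form_norm B y"
proof (cases "y = 0")
  case True
  have "B x 0 = B 0 x"
    using scalar_product_sym[OF x y] True by simp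
  then show ?thesis
    using True scalar_product_zero[OF x] scalar_product_zero[OF y] by (simp add: form_norm_def)
next
  case False
  then have pos: "0 < B y y"
    using scalar_product_pos[OF y] by simp
  let ?t = "B x y / B y y"
  have "x - ?t *\<^sub>R y \<in> S"
    by (intro subspace_diff[OF subspace] subspace_scale[OF subspace] x y)
  then have "0 \<le> B x x - 2 * ?t * B x y + ?t\<^sup>2 * B y y"
    using scalar_product_nonneg scalar_product_quadratic[OF x y, of ?t] by metis
  also have "\<dots> = B x x - (B x y)\<^sup>2 / B y y"
    using pos by (simp add: power2_eq_square field_simps)
  finally have "(B x y)\<^sup>2 \<le> B x x * B y y"
    using pos by (simp add: field_simps)
  then have "sqrt ((B x y)\<^sup>2) \<le> sqrt (B x x * B y y)"
    by (rule real_sqrt_le_mono)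
  then show ?thesis by (simp add: form_norm_def real_sqrt_mult)
qed

end

lemma coercive_scalar_product:
  fixes a :: "'v::real_normed_vector \<Rightarrow> 'v \<Rightarrow> real"
  assumes bilinear: "bounded_bilinear a" and sym: "\<And>v w. a v w = a w v"
    and coercive: "\<exists>c>0. \<forall>v. c * (norm v)\<^sup>2 \<le> a v v"
  shows "scalar_product_on UNIV a"
proof -
  have "0 < a v v" if "v \<noteq> 0" for v
  proof -
    obtain c where "c > 0" "c * (norm v)\<^sup>2 \<le> a v v" using coercive by blast
    moreover have "0 < c * (norm v)\<^sup>2" using that \<open>c > 0\<close> by simp
    ultimately show ?thesis by linarith
  qed
  then show ?thesis
    using sym bounded_bilinear.add_left[OF bilinear] bounded_bilinear.scaleR_left[OF bilinear]
    by (simp add: scalar_product_on_def)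
qed

text \<open>
  The supremum over unit vectors controls all vectors by homogeneity. The maximum with \<open>0\<close> covers
  \<open>S = {0}\<close>, where the supremum is taken over the empty set and equals \<open>-\<infinity>\<close>.
\<close>

lemma operator_norm_on_bound:
  assumes S: "subspace S" "scalar_product_on S B" and a: "scalar_product_on UNIV a"
    and lin: "linear_on_subspace S R"
    and bound: "operator_norm_on S B a R \<le> ereal L" and x: "x \<in> S"
  shows "form_norm a (R x) \<le> max 0 L * form_norm B x"
    and "L < 0 \<Longrightarrow> x = 0"
proof -
  have unit: "form_norm a (R y) \<le> L" if "y \<in> S" "form_norm B y = 1" for y
  proof -
    have "ereal (form_norm a (R y)) \<le> operator_norm_on S B a R"
      unfolding operator_norm_on_def by (rule SUP_upper) (use that in simp)
    then show ?thesis using bound by (metis ereal_less_eq(3) order_trans)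
  qed
  have norm_nonneg: "0 \<le> form_norm a z" for z
    using scalar_product_nonneg[OF subspace_UNIV a] by (simp add: form_norm_def)
  have main: "form_norm a (R x) \<le> L * form_norm B x \<and> 0 \<le> L" if "x \<noteq> 0"
  proof -
    have pos: "0 < form_norm B x"
      using scalar_product_pos[OF S x] that by (simp add: form_norm_def)
    let ?y = "inverse (form_norm B x) *\<^sub>R x"
    have y: "?y \<in> S" by (rule subspace_scale[OF S(1) x])
    have "form_norm B ?y = 1"
      using form_norm_scaleR[OF S x] pos by simp
    then have "form_norm a (R ?y) \<le> L" using unit y by blast
    moreover have "R ?y = inverse (form_norm B x) *\<^sub>R R x"
      using lin x unfolding linear_on_subspace_def by blast
    ultimately have "inverse (form_norm B x) * form_norm a (R x) \<le> L" "0 \<le> L"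
      using form_norm_scaleR[OF subspace_UNIV a, of "R x"] pos norm_nonneg[of "R ?y"] by auto
    then show ?thesis using pos by (simp add: field_simps)
  qed
  show "L < 0 \<Longrightarrow> x = 0" using main by force
  show "form_norm a (R x) \<le> max 0 L * form_norm B x"
  proof (cases "x = 0")
    case True
    have "R (0 *\<^sub>R x) = 0 *\<^sub>R R x"
      using lin x unfolding linear_on_subspace_def by blast
    then have "R x = 0" using True by simp
    then show ?thesis
      using True scalar_product_zero[OF subspace_UNIV a, of 0] scalar_product_zero[OF S x]
      by (simp add: form_norm_def)
  next
    case False
    then show ?thesis using main by (simp add: max_def)
  qed
qed

section \<open>The splitting and its search directions\<close>

locale random_splitting = prob_space \<rho>
  for \<rho> :: "'i measure" +
  fixes a :: "'v::{real_inner,banach,second_countable_topology} \<Rightarrow> 'v \<Rightarrow> real"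
    and W :: "'i \<Rightarrow> 'w::real_vector set"
    and b :: "'i \<Rightarrow> 'w \<Rightarrow> 'w \<Rightarrow> real"
    and R :: "'i \<Rightarrow> 'w \<Rightarrow> 'v"
    and T :: "'i \<Rightarrow> 'v \<Rightarrow> 'w"
    and \<Lambda> :: real
  assumes a_bilinear: "bounded_bilinear a"
    and a_sym: "\<And>v w. a v w = a w v"
    and a_coercive: "\<exists>c>0. \<forall>v. c * (norm v)\<^sup>2 \<le> a v v"
    and W_subspace: "\<And>\<omega>. \<omega> \<in> space \<rho> \<Longrightarrow> subspace (W \<omega>)"
    and b_scalar_product: "\<And>\<omega>. \<omega> \<in> space \<rho> \<Longrightarrow> scalar_product_on (W \<omega>) (b \<omega>)"
    and \<Lambda>_nonneg: "0 \<le> \<Lambda>"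
    and R_bound: "\<And>\<omega> x. \<omega> \<in> space \<rho> \<Longrightarrow> x \<in> W \<omega> \<Longrightarrow>
      form_norm a (R \<omega> x) \<le> \<Lambda> * form_norm (b \<omega>) x"
    and T_range: "\<And>\<omega> v. \<omega> \<in> space \<rho> \<Longrightarrow> T \<omega> v \<in> W \<omega>"
    and T_adjoint: "\<And>\<omega> v x. \<omega> \<in> space \<rho> \<Longrightarrow> x \<in> W \<omega> \<Longrightarrow> b \<omega> (T \<omega> v) x = a v (R \<omega> x)"
    and direction_measurable: "\<And>e. normalized_direction a R T e \<in> borel_measurable \<rho>"
begin

abbreviation energy_norm :: "'v \<Rightarrow> real" where "energy_norm \<equiv> form_norm a"

abbreviation direction :: "'v \<Rightarrow> 'i \<Rightarrow> 'v" where "direction \<equiv> normalized_direction a R T"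

lemmas a_scalar_product = coercive_scalar_product[OF a_bilinear a_sym a_coercive]

lemmas a_form =
  bounded_bilinear.add_left[OF a_bilinear] bounded_bilinear.add_right[OF a_bilinear]
  bounded_bilinear.diff_left[OF a_bilinear] bounded_bilinear.diff_right[OF a_bilinear]
  bounded_bilinear.scaleR_left[OF a_bilinear] bounded_bilinear.scaleR_right[OF a_bilinear]
  bounded_bilinear.zero_left[OF a_bilinear] bounded_bilinear.zero_right[OF a_bilinear]

lemmas energy_power2 = form_norm_power2[OF subspace_UNIV a_scalar_product UNIV_I]
lemmas energy_Cauchy_Schwarz =
  scalar_product_Cauchy_Schwarz[OF subspace_UNIV a_scalar_product UNIV_I UNIV_I]
lemmas energy_scaleR = form_norm_scaleR[OF subspace_UNIV a_scalar_product UNIV_I]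
lemmas a_pos = scalar_product_pos[OF subspace_UNIV a_scalar_product UNIV_I]
lemmas a_nonneg = scalar_product_nonneg[OF subspace_UNIV a_scalar_product UNIV_I]
lemmas a_eq_zero = scalar_product_eq_zero[OF subspace_UNIV a_scalar_product UNIV_I]
lemmas a_quadratic = scalar_product_quadratic[OF subspace_UNIV a_scalar_product UNIV_I UNIV_I]

lemma energy_nonneg [simp]: "0 \<le> energy_norm v"
  by (simp add: form_norm_def a_nonneg)

lemma energy_pos: "v \<noteq> 0 \<Longrightarrow> 0 < energy_norm v"
  by (simp add: form_norm_def a_pos)

lemma measurable_a [measurable (raw)]:
  assumes "f \<in> borel_measurable M" "g \<in> borel_measurable M"
  shows "(\<lambda>x. a (f x) (g x)) \<in> borel_measurable M"
  by (rule borel_measurable_continuous_Pair[OF assms])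
     (intro bounded_bilinear.continuous_on[OF a_bilinear] continuous_intros)

lemma measurable_energy_norm [measurable (raw)]:
  "f \<in> borel_measurable M \<Longrightarrow> (\<lambda>x. energy_norm (f x)) \<in> borel_measurable M"
  unfolding form_norm_def by measurable

text \<open>
  Both sides equal the scalar product of \<open>T \<omega> x\<close> and \<open>T \<omega> y\<close> in the local space: \<open>R \<omega> \<circ> T \<omega>\<close> is
  self-adjoint for \<open>a\<close>.
\<close>

lemma RT_self_adjoint:
  assumes \<omega>: "\<omega> \<in> space \<rho>"
  shows "a (R \<omega> (T \<omega> x)) y = a x (R \<omega> (T \<omega> y))"
  using T_adjoint[OF \<omega> T_range[OF \<omega>], of y x] T_adjoint[OF \<omega> T_range[OF \<omega>], of x y] a_sym[of _ y]
    scalar_product_sym[OF W_subspace[OF \<omega>] b_scalar_product[OF \<omega>] T_range[OF \<omega>] T_range[OF \<omega>], of x y]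
  by simp

lemma T_bound:
  assumes \<omega>: "\<omega> \<in> space \<rho>"
  shows "form_norm (b \<omega>) (T \<omega> v) \<le> \<Lambda> * energy_norm v"
proof -
  let ?n = "form_norm (b \<omega>) (T \<omega> v)"
  note T = T_range[OF \<omega>, of v]
  have n: "0 \<le> ?n"
    using scalar_product_nonneg[OF W_subspace[OF \<omega>] b_scalar_product[OF \<omega>] T]
    by (simp add: form_norm_def)
  have "?n\<^sup>2 = a v (R \<omega> (T \<omega> v))"
    using form_norm_power2[OF W_subspace[OF \<omega>] b_scalar_product[OF \<omega>] T] T_adjoint[OF \<omega> T] by simp
  also have "\<dots> \<le> energy_norm v * energy_norm (R \<omega> (T \<omega> v))"
    using energy_Cauchy_Schwarz abs_le_D1 by blast
  also have "\<dots> \<le> energy_norm v * (\<Lambda> * ?n)"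
    by (intro mult_left_mono R_bound \<omega> T energy_nonneg)
  finally have "?n * ?n \<le> (\<Lambda> * energy_norm v) * ?n" by (simp add: power2_eq_square mult_ac)
  then show ?thesis
    using n \<Lambda>_nonneg energy_nonneg[of v] by (cases "?n = 0") (auto simp: mult_le_cancel_right)
qed

text \<open>
  For the difference \<open>z\<close> of the images, self-adjointness moves the operator from \<open>x\<close> and \<open>y\<close> onto
  \<open>z\<close>, so that \<open>a z z\<close> is bounded by the norms of \<open>x - y\<close> and of the image of \<open>z\<close>.
\<close>

lemma RT_lipschitz:
  assumes \<omega>: "\<omega> \<in> space \<rho>"
  shows "energy_norm (R \<omega> (T \<omega> x) - R \<omega> (T \<omega> y)) \<le> \<Lambda>\<^sup>2 * energy_norm (x - y)"
proof -
  let ?z = "R \<omega> (T \<omega> x) - R \<omega> (T \<omega> y)"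
  have "energy_norm (R \<omega> (T \<omega> ?z)) \<le> \<Lambda> * form_norm (b \<omega>) (T \<omega> ?z)"
    by (rule R_bound[OF \<omega> T_range[OF \<omega>]])
  also have "\<dots> \<le> \<Lambda> * (\<Lambda> * energy_norm ?z)"
    by (rule mult_left_mono[OF T_bound[OF \<omega>] \<Lambda>_nonneg])
  finally have RT: "energy_norm (R \<omega> (T \<omega> ?z)) \<le> \<Lambda>\<^sup>2 * energy_norm ?z"
    by (simp add: power2_eq_square mult.assoc)
  have "(energy_norm ?z)\<^sup>2 = a ?z ?z" by (rule energy_power2)
  also have "\<dots> = a (x - y) (R \<omega> (T \<omega> ?z))"
    using RT_self_adjoint[OF \<omega>, of x ?z] RT_self_adjoint[OF \<omega>, of y ?z]
    by (simp only: a_form(3)[of "R \<omega> (T \<omega> x)"] a_form(3)[of x])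
  also have "\<dots> \<le> energy_norm (x - y) * energy_norm (R \<omega> (T \<omega> ?z))"
    using energy_Cauchy_Schwarz abs_le_D1 by blast
  also have "\<dots> \<le> energy_norm (x - y) * (\<Lambda>\<^sup>2 * energy_norm ?z)"
    by (rule mult_left_mono[OF RT energy_nonneg])
  finally have "energy_norm ?z * energy_norm ?z \<le> (\<Lambda>\<^sup>2 * energy_norm (x - y)) * energy_norm ?z"
    by (simp add: power2_eq_square mult_ac)
  then show ?thesis
    using energy_nonneg[of ?z] energy_nonneg[of "x - y"]
    by (cases "energy_norm ?z = 0") (auto simp: mult_le_cancel_right)
qed

lemma RT_tendsto:
  assumes \<omega>: "\<omega> \<in> space \<rho>" and f: "f \<longlonglongrightarrow> x"
  shows "(\<lambda>n. R \<omega> (T \<omega> (f n))) \<longlonglongrightarrow> R \<omega> (T \<omega> x)"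
proof -
  obtain c where c: "c > 0" "\<And>v. c * (norm v)\<^sup>2 \<le> a v v" using a_coercive by blast
  let ?d = "\<lambda>n. norm (R \<omega> (T \<omega> (f n)) - R \<omega> (T \<omega> x))"
  let ?g = "\<lambda>n. (\<Lambda>\<^sup>2)\<^sup>2 * a (f n - x) (f n - x) / c"
  have "(\<lambda>n. f n - x) \<longlonglongrightarrow> 0" using f by (simp add: LIM_zero)
  then have "(\<lambda>n. a (f n - x) (f n - x)) \<longlonglongrightarrow> a 0 0"
    by (intro bounded_bilinear.tendsto[OF a_bilinear])
  then have "?g \<longlonglongrightarrow> (\<Lambda>\<^sup>2)\<^sup>2 * a 0 0 / c"
    using c(1) by (intro tendsto_intros) auto
  then have g: "?g \<longlonglongrightarrow> 0" by (simp add: a_form)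
  have le: "(?d n)\<^sup>2 \<le> ?g n" for n
  proof -
    let ?z = "R \<omega> (T \<omega> (f n)) - R \<omega> (T \<omega> x)"
    have "c * (?d n)\<^sup>2 \<le> (energy_norm ?z)\<^sup>2" using c(2) by (simp add: energy_power2)
    also have "\<dots> \<le> (\<Lambda>\<^sup>2 * energy_norm (f n - x))\<^sup>2"
      by (rule power_mono[OF RT_lipschitz[OF \<omega>] energy_nonneg])
    also have "\<dots> = (\<Lambda>\<^sup>2)\<^sup>2 * a (f n - x) (f n - x)"
      by (simp only: power_mult_distrib energy_power2)
    finally show ?thesis using c(1) by (simp add: field_simps)
  qed
  have "(\<lambda>n. (?d n)\<^sup>2) \<longlonglongrightarrow> 0"
    by (rule tendsto_sandwich[OF _ _ tendsto_const g]) (use le in auto)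
  then have "(\<lambda>n. sqrt ((?d n)\<^sup>2)) \<longlonglongrightarrow> sqrt 0" by (rule tendsto_real_sqrt)
  then have "?d \<longlonglongrightarrow> 0" by simp
  then show ?thesis using LIM_zero_cancel tendsto_norm_zero_iff by blast
qed

lemma direction_tendsto:
  assumes \<omega>: "\<omega> \<in> space \<rho>" and f: "f \<longlonglongrightarrow> x" and nz: "R \<omega> (T \<omega> x) \<noteq> 0"
  shows "(\<lambda>n. direction (f n) \<omega>) \<longlonglongrightarrow> direction x \<omega>"
proof -
  let ?A = "\<lambda>v. R \<omega> (T \<omega> v)"
  have A: "(\<lambda>n. ?A (f n)) \<longlonglongrightarrow> ?A x" by (rule RT_tendsto[OF \<omega> f])
  then have "(\<lambda>n. energy_norm (?A (f n))) \<longlonglongrightarrow> energy_norm (?A x)"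
    unfolding form_norm_def by (intro tendsto_real_sqrt bounded_bilinear.tendsto[OF a_bilinear])
  then have lim: "(\<lambda>n. ?A (f n) /\<^sub>R energy_norm (?A (f n))) \<longlonglongrightarrow> ?A x /\<^sub>R energy_norm (?A x)"
    using A energy_pos[OF nz] by (intro tendsto_intros) auto
  have "direction v \<omega> = ?A v /\<^sub>R energy_norm (?A v)" for v
    by (simp add: normalized_direction_def)
  then show ?thesis using lim by simp
qed

text \<open>
  The kernel of a self-adjoint operator is the orthogonal complement of its range, and by continuity
  the images of a dense set suffice to test orthogonality. This describes the kernel, which depends
  on \<open>\<omega>\<close>, by directions belonging to fixed vectors.
\<close>

lemma RT_kernel_iff:
  assumes \<omega>: "\<omega> \<in> space \<rho>"
    and dense: "\<And>x. \<exists>f. (\<forall>n. f n \<in> D) \<and> f \<longlonglongrightarrow> x"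
  shows "R \<omega> (T \<omega> e) = 0 \<longleftrightarrow> (\<forall>x\<in>D. a e (direction x \<omega>) = 0)"
proof
  assume "R \<omega> (T \<omega> e) = 0"
  then have "a e (R \<omega> (T \<omega> x)) = 0" for x
    using RT_self_adjoint[OF \<omega>, of e x] by (simp add: a_form)
  then show "\<forall>x\<in>D. a e (direction x \<omega>) = 0"
    by (simp add: normalized_direction_def a_form)
next
  assume *: "\<forall>x\<in>D. a e (direction x \<omega>) = 0"
  let ?z = "R \<omega> (T \<omega> e)"
  have zero: "a ?z x = 0" if x: "x \<in> D" for x
  proof -
    have "a e (R \<omega> (T \<omega> x)) = 0"
      using *[rule_format, OF x] energy_pos[of "R \<omega> (T \<omega> x)"]
      by (cases "R \<omega> (T \<omega> x) = 0") (auto simp: normalized_direction_def a_form)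
    then show ?thesis by (simp add: RT_self_adjoint[OF \<omega>])
  qed
  obtain f where f: "\<And>n. f n \<in> D" "f \<longlonglongrightarrow> ?z" using dense by blast
  have "(\<lambda>n. a ?z (f n)) \<longlonglongrightarrow> a ?z ?z"
    by (intro bounded_bilinear.tendsto[OF a_bilinear] tendsto_const f)
  then have "(\<lambda>n. 0::real) \<longlonglongrightarrow> a ?z ?z" using zero f(1) by simp
  then have "a ?z ?z = 0" using LIMSEQ_unique tendsto_const by blast
  then show "?z = 0" by (rule a_eq_zero)
qed

text \<open>
  Off the kernel of \<open>R \<omega> \<circ> T \<omega>\<close> the direction depends continuously on the vector, so that it is the
  limit of the directions of simple approximations, which are measurable by assumption. On the kernel
  the approximations need not converge; there the direction is \<open>0\<close>, and the pairs \<open>(e, \<omega>)\<close> with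
  \<open>e\<close> in the kernel form a measurable set by the countable test for the kernel.
\<close>

lemma direction_jointly_measurable:
  "(\<lambda>(e, \<omega>). direction e \<omega>) \<in> borel_measurable (borel \<Otimes>\<^sub>M \<rho>)"
proof -
  obtain F :: "nat \<Rightarrow> 'v \<Rightarrow> 'v" where F: "\<And>i. simple_function borel (F i)"
    and lim: "\<And>x. (\<lambda>i. F i x) \<longlonglongrightarrow> x"
    using borel_measurable_implies_sequence_metric[of "\<lambda>x::'v. x" borel 0] by auto
  define D where "D = (\<Union>i. range (F i))"
  have fin: "finite (range (F i))" for i
    using F[of i] by (simp add: simple_function_def)
  have dense: "\<exists>f. (\<forall>n. f n \<in> D) \<and> f \<longlonglongrightarrow> x" for x
    using lim[of x] by (intro exI[of _ "\<lambda>i. F i x"]) (auto simp: D_def)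
  note direction_measurable [measurable]
  (* P e \<omega> says that e lies in the kernel. The test vectors range over countably many finite sets. *)
  define P where "P = (\<lambda>p::'v \<times> 'i. \<forall>x\<in>D. a (fst p) (direction x (snd p)) = 0)"
  have P [measurable]: "Measurable.pred (borel \<Otimes>\<^sub>M \<rho>) P"
    unfolding P_def D_def ball_UN
    by (rule pred_intros_countable_bounded(3), rule pred_intros_finite(3)[OF fin]) measurable
  have approx [measurable]:
    "(\<lambda>p. direction (F i (fst p)) (snd p)) \<in> borel_measurable (borel \<Otimes>\<^sub>M \<rho>)" for i
  proof (rule measurable_compose_countable'[where I = "range (F i)"
        and f = "\<lambda>x p. direction x (snd p)" and g = "\<lambda>p. F i (fst p)"])
    show "(\<lambda>p. F i (fst p)) \<in> measurable (borel \<Otimes>\<^sub>M \<rho>) (count_space (range (F i)))"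
      using simple_functionD(2)[OF F]
      by (intro measurable_compose[OF measurable_fst])
         (simp add: measurable_count_space_eq2[OF fin])
    show "countable (range (F i))" using fin by (rule countable_finite)
  qed measurable
  show ?thesis
  proof (rule borel_measurable_LIMSEQ_metric)
    fix i
    show "(\<lambda>p. if P p then 0 else direction (F i (fst p)) (snd p)) \<in> borel_measurable (borel \<Otimes>\<^sub>M \<rho>)"
      by measurable
  next
    fix p assume "p \<in> space (borel \<Otimes>\<^sub>M \<rho> :: ('v \<times> 'i) measure)"
    then obtain e \<omega> where p: "p = (e, \<omega>)" and \<omega>: "\<omega> \<in> space \<rho>"
      by (auto simp: space_pair_measure)
    have iff: "P p \<longleftrightarrow> R \<omega> (T \<omega> e) = 0"
      using RT_kernel_iff[OF \<omega> dense, of e] by (simp add: P_def p)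
    show "(\<lambda>i. if P p then 0 else direction (F i (fst p)) (snd p))
        \<longlonglongrightarrow> (case p of (e, \<omega>) \<Rightarrow> direction e \<omega>)"
    proof (cases "P p")
      case True
      then show ?thesis using iff by (simp add: p normalized_direction_def)
    next
      case False
      then show ?thesis using direction_tendsto[OF \<omega> lim] iff by (simp add: p)
    qed
  qed
qed

section \<open>The error of one step\<close>

lemma direction_norm: "direction e \<omega> = 0 \<or> energy_norm (direction e \<omega>) = 1"
  using energy_pos[of "R \<omega> (T \<omega> e)"]
  by (auto simp: normalized_direction_def energy_scaleR)

lemma direction_norm_le_1: "energy_norm (direction e \<omega>) \<le> 1"
  using direction_norm[of e \<omega>] by (auto simp: form_norm_def a_form)

definition residual :: "'v \<Rightarrow> 'v \<Rightarrow> 'v" where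
  "residual p \<psi> = p - a p \<psi> *\<^sub>R \<psi>"

lemma residual_minimal:
  "(energy_norm (residual p (direction e \<omega>)))\<^sup>2 \<le> (energy_norm (p - t *\<^sub>R direction e \<omega>))\<^sup>2"
proof (cases "direction e \<omega> = 0")
  case True
  then show ?thesis by (simp add: residual_def)
next
  case False
  then have "a (direction e \<omega>) (direction e \<omega>) = 1"
    using direction_norm[of e \<omega>] energy_power2[of "direction e \<omega>"] by simp
  moreover have "0 \<le> (t - a p (direction e \<omega>))\<^sup>2" by simp
  ultimately show ?thesis
    unfolding residual_def energy_power2 a_quadratic by (simp add: power2_eq_square algebra_simps)
qed

text \<open>
  Along a nonzero \<open>d\<close> the squared distance is a strictly convex quadratic function with vertex
  \<open>a p d / a d d\<close>, so that the line search subtracts the orthogonal projection onto the line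
  through \<open>d\<close>. A step length for \<open>d\<close> need not be a measurable function of the sample, as only the
  normalized directions are assumed to be measurable; the projection is one.
\<close>

lemma line_search:
  "arg_min (\<lambda>\<xi>::real. (energy_norm (p - \<xi> *\<^sub>R d))\<^sup>2) (\<lambda>_. True) *\<^sub>R d
    = a p (d /\<^sub>R energy_norm d) *\<^sub>R (d /\<^sub>R energy_norm d)"
proof (cases "d = 0")
  case False
  let ?q = "\<lambda>\<xi>::real. (energy_norm (p - \<xi> *\<^sub>R d))\<^sup>2"
  let ?t = "a p d / a d d"
  have pos: "0 < a d d" by (rule a_pos[OF False])
  have q: "?q \<xi> = ?q ?t + (\<xi> - ?t)\<^sup>2 * a d d" for \<xi>
    unfolding energy_power2 a_quadratic using pos by (simp add: power2_eq_square field_simps)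
  have "arg_min ?q (\<lambda>_. True) = ?t"
  proof (rule arg_minI)
    show "\<not> ?q y < ?q ?t" for y
    proof -
      have "0 \<le> (y - ?t)\<^sup>2 * a d d" using pos by simp
      then show ?thesis using q[of y] by linarith
    qed
    fix x assume "\<forall>y. True \<longrightarrow> \<not> ?q y < ?q x"
    then have "?q x \<le> ?q ?t" by (simp add: not_less)
    then have "(x - ?t)\<^sup>2 * a d d \<le> 0" using q[of x] by linarith
    then have "(x - ?t)\<^sup>2 \<le> 0" using pos by (simp add: mult_le_0_iff)
    then show "x = ?t" by simp
  qed simp
  moreover have "a d d = energy_norm d * energy_norm d"
    using energy_power2[of d] by (simp add: power2_eq_square)
  ultimately show ?thesis
    by (simp add: a_form divide_inverse)
qed simp

lemma error_step:
  "u - iterate a R T u s (Suc m) =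
    residual (relaxation m *\<^sub>R (u - iterate a R T u s m) + (1 - relaxation m) *\<^sub>R u)
      (direction (u - iterate a R T u s m) (s m))"
proof -
  let ?w = "iterate a R T u s m"
  let ?d = "R (s m) (T (s m) (u - ?w))"
  have dir: "direction (u - ?w) (s m) = ?d /\<^sub>R energy_norm ?d"
    by (simp add: normalized_direction_def)
  have p: "relaxation m *\<^sub>R (u - ?w) + (1 - relaxation m) *\<^sub>R u = u - relaxation m *\<^sub>R ?w"
    by (simp add: algebra_simps)
  show ?thesis
    unfolding residual_def dir p line_search[of "u - relaxation m *\<^sub>R ?w" ?d, symmetric]
    by (simp add: Let_def algebra_simps)
qed

text \<open>
  By the adjoint relation \<open>\<parallel>T \<omega> e\<parallel>\<^sup>2 = a e (R \<omega> (T \<omega> e))\<close>, and \<open>R \<omega> (T \<omega> e)\<close> is the multiple of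
  the direction by its norm, which is at most \<open>\<Lambda> \<parallel>T \<omega> e\<parallel>\<close>. Divide by \<open>\<parallel>T \<omega> e\<parallel>\<close>.
\<close>

lemma T_norm_le_direction:
  assumes \<omega>: "\<omega> \<in> space \<rho>"
  shows "form_norm (b \<omega>) (T \<omega> e) \<le> \<Lambda> * a e (direction e \<omega>)"
proof -
  let ?n = "form_norm (b \<omega>) (T \<omega> e)" and ?d = "R \<omega> (T \<omega> e)"
  note T = T_range[OF \<omega>, of e]
  have n: "0 \<le> ?n"
    using scalar_product_nonneg[OF W_subspace[OF \<omega>] b_scalar_product[OF \<omega>] T]
    by (simp add: form_norm_def)
  have sq: "?n\<^sup>2 = a e ?d"
    using form_norm_power2[OF W_subspace[OF \<omega>] b_scalar_product[OF \<omega>] T] T_adjoint[OF \<omega> T] by simp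
  show ?thesis
  proof (cases "?d = 0")
    case True
    then show ?thesis using sq by (simp add: a_form normalized_direction_def)
  next
    case False
    then have pos: "0 < energy_norm ?d" by (rule energy_pos)
    have "energy_norm ?d * ?n \<le> (\<Lambda> * ?n) * ?n"
      by (rule mult_right_mono[OF R_bound[OF \<omega> T] n])
    also have "\<dots> = \<Lambda> * a e ?d" by (simp add: sq[symmetric] power2_eq_square)
    finally have "?n \<le> \<Lambda> * (a e ?d / energy_norm ?d)"
      using pos by (simp add: field_simps)
    moreover have "a e (direction e \<omega>) = a e ?d / energy_norm ?d"
      using False by (simp add: normalized_direction_def a_form divide_inverse mult.commute)
    ultimately show ?thesis by simp
  qed
qed

context
  fixes u :: 'v and v :: "'i \<Rightarrow> 'w"
  assumes representation: "A2_representation \<rho> W b R u v"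
begin

abbreviation local_norm :: "'i \<Rightarrow> real" where
  "local_norm \<omega> \<equiv> form_norm (b \<omega>) (v \<omega>)"

abbreviation representation_norm :: real where
  "representation_norm \<equiv> sqrt (\<integral>\<omega>. (local_norm \<omega>)\<^sup>2 \<partial>\<rho>)"

lemma v_in_W: "\<omega> \<in> space \<rho> \<Longrightarrow> v \<omega> \<in> W \<omega>"
  using representation by (simp add: A2_representation_def)

lemma local_norm_nonneg: "\<omega> \<in> space \<rho> \<Longrightarrow> 0 \<le> local_norm \<omega>"
  using scalar_product_nonneg[OF W_subspace b_scalar_product v_in_W] by (simp add: form_norm_def)

lemma local_norm_measurable [measurable]: "local_norm \<in> borel_measurable \<rho>"
  using representation by (simp add: A2_representation_def)

lemma integrable_local_norm_power2: "integrable \<rho> (\<lambda>\<omega>. (local_norm \<omega>)\<^sup>2)"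
  using representation by (simp add: A2_representation_def)

lemma integrable_local_norm: "integrable \<rho> local_norm"
  by (rule square_integrable_imp_integrable[OF local_norm_measurable integrable_local_norm_power2])

lemma representation_norm_power2: "representation_norm\<^sup>2 = (\<integral>\<omega>. (local_norm \<omega>)\<^sup>2 \<partial>\<rho>)"
  by simp

lemma integral_local_norm_le: "(\<integral>\<omega>. local_norm \<omega> \<partial>\<rho>) \<le> representation_norm"
proof -
  have "0 \<le> variance local_norm" by (rule variance_positive)
  also have "\<dots> = (\<integral>\<omega>. (local_norm \<omega>)\<^sup>2 \<partial>\<rho>) - (\<integral>\<omega>. local_norm \<omega> \<partial>\<rho>)\<^sup>2"
    by (rule variance_eq[OF integrable_local_norm integrable_local_norm_power2])
  finally show ?thesis by (intro real_le_rsqrt) simp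
qed

lemma integrable_correlation: "integrable \<rho> (\<lambda>\<omega>. a e (direction e \<omega>) * local_norm \<omega>)"
proof (rule Bochner_Integration.integrable_bound)
  show "integrable \<rho> (\<lambda>\<omega>. energy_norm e * local_norm \<omega>)"
    using integrable_local_norm by simp
  note direction_measurable [measurable]
  show "(\<lambda>\<omega>. a e (direction e \<omega>) * local_norm \<omega>) \<in> borel_measurable \<rho>" by measurable
  have "\<bar>a e (direction e \<omega>)\<bar> \<le> energy_norm e" for \<omega>
    using energy_Cauchy_Schwarz[of e "direction e \<omega>"]
      mult_left_mono[OF direction_norm_le_1[of e \<omega>] energy_nonneg[of e]] by simp
  then show "AE \<omega> in \<rho>. norm (a e (direction e \<omega>) * local_norm \<omega>)
      \<le> norm (energy_norm e * local_norm \<omega>)"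
    by (intro AE_I2) (simp add: abs_mult mult_right_mono)
qed

text \<open>
  Testing the representation of \<open>u\<close> with \<open>e\<close> gives
  \<open>a e u = \<integral> b \<omega> (T \<omega> e) (v \<omega>)\<close>. So if the error \<open>e\<close> correlates with \<open>u\<close>, it correlates on average
  with its search directions.
\<close>

lemma correlation_bound:
  "a e u \<le> \<Lambda> * (\<integral>\<omega>. a e (direction e \<omega>) * local_norm \<omega> \<partial>\<rho>)"
proof -
  have "has_bochner_integral \<rho> (\<lambda>\<omega>. R \<omega> (v \<omega>)) u"
    using representation by (simp add: A2_representation_def)
  then have hb: "has_bochner_integral \<rho> (\<lambda>\<omega>. a e (R \<omega> (v \<omega>))) (a e u)"
    by (rule has_bochner_integral_bounded_linear[OF bounded_bilinear.bounded_linear_right[OF a_bilinear]])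
  have "a e u = (\<integral>\<omega>. a e (R \<omega> (v \<omega>)) \<partial>\<rho>)"
    using hb by (simp add: has_bochner_integral_integral_eq)
  also have "\<dots> \<le> (\<integral>\<omega>. \<Lambda> * (a e (direction e \<omega>) * local_norm \<omega>) \<partial>\<rho>)"
  proof (rule integral_mono)
    show "integrable \<rho> (\<lambda>\<omega>. a e (R \<omega> (v \<omega>)))" using hb by (rule integrable.intros)
    show "integrable \<rho> (\<lambda>\<omega>. \<Lambda> * (a e (direction e \<omega>) * local_norm \<omega>))"
      by (rule integrable_mult_right) (rule integrable_correlation)
    fix \<omega> assume \<omega>: "\<omega> \<in> space \<rho>"
    have "a e (R \<omega> (v \<omega>)) = b \<omega> (T \<omega> e) (v \<omega>)"
      using T_adjoint[OF \<omega> v_in_W[OF \<omega>]] by simp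
    also have "\<dots> \<le> form_norm (b \<omega>) (T \<omega> e) * local_norm \<omega>"
      using scalar_product_Cauchy_Schwarz[OF W_subspace[OF \<omega>] b_scalar_product[OF \<omega>] T_range[OF \<omega>] v_in_W[OF \<omega>]]
      by (rule abs_le_D1)
    also have "\<dots> \<le> \<Lambda> * a e (direction e \<omega>) * local_norm \<omega>"
      by (rule mult_right_mono[OF T_norm_le_direction[OF \<omega>] local_norm_nonneg[OF \<omega>]])
    finally show "a e (R \<omega> (v \<omega>)) \<le> \<Lambda> * (a e (direction e \<omega>) * local_norm \<omega>)"
      by (simp add: mult.assoc)
  qed
  also have "\<dots> = \<Lambda> * (\<integral>\<omega>. a e (direction e \<omega>) * local_norm \<omega> \<partial>\<rho>)"
    by (rule integral_mult_right_zero)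
  finally show ?thesis .
qed

text \<open>
  The line search is at least as good as the step of length \<open>\<beta> \<Lambda> \<parallel>v \<omega>\<parallel>\<close> along the direction \<open>\<psi>\<close>,
  which leaves \<open>\<alpha> e + \<beta> (u - \<Lambda> \<parallel>v \<omega>\<parallel> \<psi>)\<close>. The length is chosen such that the mixed term of the
  squared norm has nonpositive mean, because \<open>e\<close> correlates with the directions. This step depends on
  the unknown representation of \<open>u\<close> and serves for comparison only.
\<close>

lemma expected_step:
  assumes \<alpha>: "0 \<le> \<alpha>" and \<beta>: "0 \<le> \<beta>"
  shows "(\<integral>\<^sup>+\<omega>. ennreal ((energy_norm (residual (\<alpha> *\<^sub>R e + \<beta> *\<^sub>R u) (direction e \<omega>)))\<^sup>2) \<partial>\<rho>)
    \<le> ennreal (\<alpha>\<^sup>2 * (energy_norm e)\<^sup>2 + \<beta>\<^sup>2 * (\<Lambda> * representation_norm + energy_norm u)\<^sup>2)"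
proof -
  let ?c = "\<lambda>\<omega>. a e (direction e \<omega>) * local_norm \<omega>"
  let ?U = "energy_norm u" and ?I = "\<integral>\<omega>. local_norm \<omega> \<partial>\<rho>" and ?C = "\<integral>\<omega>. ?c \<omega> \<partial>\<rho>"
  define h where "h \<omega> = (\<alpha>\<^sup>2 * (energy_norm e)\<^sup>2 + 2 * \<alpha> * \<beta> * a e u + \<beta>\<^sup>2 * ?U\<^sup>2)
      - 2 * \<alpha> * \<beta> * \<Lambda> * ?c \<omega> + 2 * \<beta>\<^sup>2 * \<Lambda> * ?U * local_norm \<omega>
      + \<beta>\<^sup>2 * \<Lambda>\<^sup>2 * (local_norm \<omega>)\<^sup>2" for \<omega>
  note ints = integrable_correlation integrable_local_norm integrable_local_norm_power2
  have h_int: "integrable \<rho> h" unfolding h_def using ints by simp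
  have h_eq: "(\<integral>\<omega>. h \<omega> \<partial>\<rho>) = (\<alpha>\<^sup>2 * (energy_norm e)\<^sup>2 + 2 * \<alpha> * \<beta> * a e u + \<beta>\<^sup>2 * ?U\<^sup>2)
      - 2 * \<alpha> * \<beta> * \<Lambda> * ?C + 2 * \<beta>\<^sup>2 * \<Lambda> * ?U * ?I + \<beta>\<^sup>2 * \<Lambda>\<^sup>2 * representation_norm\<^sup>2"
    unfolding h_def representation_norm_power2 using ints by (simp add: prob_space)
  have le: "(energy_norm (residual (\<alpha> *\<^sub>R e + \<beta> *\<^sub>R u) (direction e \<omega>)))\<^sup>2 \<le> h \<omega>"
    if \<omega>: "\<omega> \<in> space \<rho>" for \<omega>
  proof -
    let ?\<psi> = "direction e \<omega>" and ?l = "\<Lambda> * local_norm \<omega>"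
    have l: "0 \<le> ?l" using \<Lambda>_nonneg local_norm_nonneg[OF \<omega>] by simp
    have "a ?\<psi> ?\<psi> = (energy_norm ?\<psi>)\<^sup>2" by (simp add: energy_power2)
    also have "\<dots> \<le> 1" using direction_norm_le_1[of e \<omega>] by (simp add: power_le_one)
    finally have \<psi>\<psi>: "?l\<^sup>2 * a ?\<psi> ?\<psi> \<le> ?l\<^sup>2" by (simp add: mult_left_le)
    have "- a u ?\<psi> \<le> ?U * energy_norm ?\<psi>"
      using energy_Cauchy_Schwarz abs_le_D2 by blast
    also have "\<dots> \<le> ?U * 1" by (rule mult_left_mono[OF direction_norm_le_1 energy_nonneg])
    finally have u\<psi>: "?l * (- a u ?\<psi>) \<le> ?l * ?U" using l by (intro mult_left_mono) auto
    have mono: "2 * (?l * (- a u ?\<psi>)) + ?l\<^sup>2 * a ?\<psi> ?\<psi> \<le> 2 * (?l * ?U) + ?l\<^sup>2"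
      using \<psi>\<psi> u\<psi> by (intro add_mono) linarith+
    have "(energy_norm (residual (\<alpha> *\<^sub>R e + \<beta> *\<^sub>R u) ?\<psi>))\<^sup>2
        \<le> (energy_norm ((\<alpha> *\<^sub>R e + \<beta> *\<^sub>R u) - (\<beta> * ?l) *\<^sub>R ?\<psi>))\<^sup>2"
      by (rule residual_minimal)
    also have "\<dots> = \<alpha>\<^sup>2 * a e e + 2 * \<alpha> * \<beta> * a e u + \<beta>\<^sup>2 * a u u
        - 2 * \<alpha> * \<beta> * ?l * a e ?\<psi> + \<beta>\<^sup>2 * (2 * (?l * (- a u ?\<psi>)) + ?l\<^sup>2 * a ?\<psi> ?\<psi>)"
      unfolding energy_power2 a_quadratic
      by (simp add: a_form a_sym[of u e] power2_eq_square algebra_simps)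
    also have "\<dots> \<le> \<alpha>\<^sup>2 * a e e + 2 * \<alpha> * \<beta> * a e u + \<beta>\<^sup>2 * a u u
        - 2 * \<alpha> * \<beta> * ?l * a e ?\<psi> + \<beta>\<^sup>2 * (2 * (?l * ?U) + ?l\<^sup>2)"
      using mono by (intro add_left_mono mult_left_mono) auto
    also have "\<dots> = h \<omega>"
      by (simp add: h_def energy_power2 power_mult_distrib algebra_simps)
    finally show ?thesis .
  qed
  have h_nonneg: "AE \<omega> in \<rho>. 0 \<le> h \<omega>"
    using le by (intro AE_I2) (meson order_trans zero_le_power2)
  have "(\<integral>\<^sup>+\<omega>. ennreal ((energy_norm (residual (\<alpha> *\<^sub>R e + \<beta> *\<^sub>R u) (direction e \<omega>)))\<^sup>2) \<partial>\<rho>)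
      \<le> (\<integral>\<^sup>+\<omega>. ennreal (h \<omega>) \<partial>\<rho>)"
    by (intro nn_integral_mono ennreal_leI le)
  also have "\<dots> = ennreal (\<integral>\<omega>. h \<omega> \<partial>\<rho>)"
    by (rule nn_integral_eq_integral[OF h_int h_nonneg])
  also have "\<dots> \<le> ennreal (\<alpha>\<^sup>2 * (energy_norm e)\<^sup>2 + \<beta>\<^sup>2 * (\<Lambda> * representation_norm + ?U)\<^sup>2)"
  proof (rule ennreal_leI)
    have "(2 * \<alpha> * \<beta>) * a e u \<le> (2 * \<alpha> * \<beta>) * (\<Lambda> * ?C)"
      using \<alpha> \<beta> by (intro mult_left_mono correlation_bound) simp
    moreover have "(2 * \<beta>\<^sup>2 * \<Lambda> * ?U) * ?I \<le> (2 * \<beta>\<^sup>2 * \<Lambda> * ?U) * representation_norm"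
      using \<Lambda>_nonneg by (intro mult_left_mono integral_local_norm_le) simp
    ultimately have "(\<integral>\<omega>. h \<omega> \<partial>\<rho>) \<le> \<alpha>\<^sup>2 * (energy_norm e)\<^sup>2 + \<beta>\<^sup>2 * ?U\<^sup>2
        + 2 * \<beta>\<^sup>2 * \<Lambda> * ?U * representation_norm + \<beta>\<^sup>2 * \<Lambda>\<^sup>2 * representation_norm\<^sup>2"
      unfolding h_eq by (simp only: mult.assoc)
    also have "\<dots> = \<alpha>\<^sup>2 * (energy_norm e)\<^sup>2 + \<beta>\<^sup>2 * (\<Lambda> * representation_norm + ?U)\<^sup>2"
      by (simp only: power2_sum power_mult_distrib distrib_left) (simp add: mult_ac)
    finally show "(\<integral>\<omega>. h \<omega> \<partial>\<rho>)
        \<le> \<alpha>\<^sup>2 * (energy_norm e)\<^sup>2 + \<beta>\<^sup>2 * (\<Lambda> * representation_norm + ?U)\<^sup>2" .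
  qed
  finally show ?thesis .
qed

end

section \<open>Expectation over the samples\<close>

lemma iterate_cong: "(\<And>k. k < m \<Longrightarrow> s k = s' k) \<Longrightarrow> iterate a R T u s m = iterate a R T u s' m"
  by (induction m) (simp_all add: Let_def)

lemma iterate_measurable:
  "(\<lambda>s. iterate a R T u s m) \<in> borel_measurable (\<Pi>\<^sub>M k\<in>{..<m}. \<rho>)"
proof (induction m)
  case (Suc m)
  let ?P = "\<Pi>\<^sub>M k\<in>{..<Suc m}. \<rho>"
  have "(\<lambda>s. iterate a R T u (restrict s {..<m}) m) \<in> borel_measurable ?P"
    by (rule measurable_compose[OF measurable_restrict_subset Suc]) auto
  moreover have "iterate a R T u (restrict s {..<m}) m = iterate a R T u s m" for s
    by (rule iterate_cong) simp
  ultimately have [measurable]: "(\<lambda>s. iterate a R T u s m) \<in> borel_measurable ?P" by simp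
  have [measurable]: "(\<lambda>s. s m) \<in> measurable ?P \<rho>"
    by (rule measurable_component_singleton) simp
  have "(\<lambda>s. (u - iterate a R T u s m, s m)) \<in> measurable ?P (borel \<Otimes>\<^sub>M \<rho>)" by measurable
  from measurable_compose[OF this direction_jointly_measurable]
  have [measurable]: "(\<lambda>s. direction (u - iterate a R T u s m) (s m)) \<in> borel_measurable ?P" by simp
  have "(\<lambda>s. u - (u - iterate a R T u s (Suc m))) \<in> borel_measurable ?P"
    unfolding error_step residual_def by measurable
  then show ?case by (simp del: iterate.simps)
qed simp

text \<open>
  Conditioning on the first \<open>m\<close> samples, \<open>E \<delta>\<^sub>m\<^sub>+\<^sub>1\<^sup>2 \<le> \<alpha>\<^sup>2 E \<delta>\<^sub>m\<^sup>2 + (1 - \<alpha>)\<^sup>2 C\<close> with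
  \<open>\<alpha> = (m + 1) / (m + 2)\<close>, and \<open>C / (m + 1)\<close> satisfies this recursion with equality. The initial
  error is \<open>\<parallel>u\<parallel>\<^sup>2\<close>, which is at most \<open>C\<close>.
\<close>

lemma expected_error:
  assumes rep: "A2_representation \<rho> W b R u v"
  defines "C \<equiv> (\<Lambda> * sqrt (\<integral>\<omega>. (form_norm (b \<omega>) (v \<omega>))\<^sup>2 \<partial>\<rho>) + energy_norm u)\<^sup>2"
  shows "(\<integral>\<^sup>+s. ennreal ((energy_norm (u - iterate a R T u s m))\<^sup>2) \<partial>(\<Pi>\<^sub>M k\<in>{..<m}. \<rho>))
    \<le> ennreal (C / (real m + 1))"
proof (induction m)
  case 0
  interpret P: prob_space "\<Pi>\<^sub>M k\<in>{..<0::nat}. \<rho>"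
    by (intro prob_space_PiM prob_space_axioms)
  have "energy_norm u \<le> \<Lambda> * sqrt (\<integral>\<omega>. (form_norm (b \<omega>) (v \<omega>))\<^sup>2 \<partial>\<rho>) + energy_norm u"
    using \<Lambda>_nonneg by simp
  then have "(energy_norm u)\<^sup>2 \<le> C" unfolding C_def by (rule power_mono) simp
  then have "ennreal ((energy_norm u)\<^sup>2) \<le> ennreal C" by (rule ennreal_leI)
  then show ?case by (simp add: P.emeasure_space_1 del: lessThan_0)
next
  case (Suc m)
  interpret prod: product_sigma_finite "\<lambda>_::nat. \<rho>"
    by unfold_locales
  interpret P: prob_space "\<Pi>\<^sub>M k\<in>{..<m}. \<rho>"
    by (intro prob_space_PiM prob_space_axioms)
  let ?\<alpha> = "relaxation m" and ?\<beta> = "1 - relaxation m"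
  let ?e = "\<lambda>s. u - iterate a R T u s m"
  have \<alpha>: "?\<alpha> = (real m + 1) / (real m + 2)" by (simp add: relaxation_def field_simps)
  have \<beta>: "?\<beta> = 1 / (real m + 2)" by (simp add: relaxation_def)
  have C: "0 \<le> C" by (simp add: C_def)
  note iterate_measurable [measurable]
  have "(\<integral>\<^sup>+s. ennreal ((energy_norm (u - iterate a R T u s (Suc m)))\<^sup>2) \<partial>(\<Pi>\<^sub>M k\<in>{..<Suc m}. \<rho>))
      = (\<integral>\<^sup>+s. \<integral>\<^sup>+\<omega>. ennreal ((energy_norm (u - iterate a R T u (s(m := \<omega>)) (Suc m)))\<^sup>2) \<partial>\<rho>
          \<partial>(\<Pi>\<^sub>M k\<in>{..<m}. \<rho>))"
    unfolding lessThan_Suc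
    by (rule prod.product_nn_integral_insert)
       (simp_all add: lessThan_Suc[symmetric] iterate_measurable measurable_energy_norm
         borel_measurable_diff borel_measurable_power del: iterate.simps)
  also have "\<dots> \<le> (\<integral>\<^sup>+s. ennreal (?\<alpha>\<^sup>2 * (energy_norm (?e s))\<^sup>2 + ?\<beta>\<^sup>2 * C) \<partial>(\<Pi>\<^sub>M k\<in>{..<m}. \<rho>))"
  proof (rule nn_integral_mono)
    fix s :: "nat \<Rightarrow> 'i"
    have past: "iterate a R T u (s(m := \<omega>)) m = iterate a R T u s m" for \<omega>
      by (rule iterate_cong) simp
    have "u - iterate a R T u (s(m := \<omega>)) (Suc m)
        = residual (?\<alpha> *\<^sub>R ?e s + ?\<beta> *\<^sub>R u) (direction (?e s) \<omega>)" for \<omega>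
      unfolding error_step past by simp
    then show "(\<integral>\<^sup>+\<omega>. ennreal ((energy_norm (u - iterate a R T u (s(m := \<omega>)) (Suc m)))\<^sup>2) \<partial>\<rho>)
        \<le> ennreal (?\<alpha>\<^sup>2 * (energy_norm (?e s))\<^sup>2 + ?\<beta>\<^sup>2 * C)"
      using expected_step[OF rep, of ?\<alpha> ?\<beta> "?e s"] by (simp add: \<alpha> \<beta> C_def del: iterate.simps)
  qed
  also have "\<dots> = (\<integral>\<^sup>+s. ennreal (?\<alpha>\<^sup>2) * ennreal ((energy_norm (?e s))\<^sup>2) + ennreal (?\<beta>\<^sup>2 * C)
      \<partial>(\<Pi>\<^sub>M k\<in>{..<m}. \<rho>))"
    using C by (simp add: ennreal_plus ennreal_mult)
  also have "\<dots> = ennreal (?\<alpha>\<^sup>2) * (\<integral>\<^sup>+s. ennreal ((energy_norm (?e s))\<^sup>2) \<partial>(\<Pi>\<^sub>M k\<in>{..<m}. \<rho>))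
      + ennreal (?\<beta>\<^sup>2 * C)"
    by (subst nn_integral_add) (simp_all add: nn_integral_cmult P.emeasure_space_1)
  also have "\<dots> \<le> ennreal (?\<alpha>\<^sup>2) * ennreal (C / (real m + 1)) + ennreal (?\<beta>\<^sup>2 * C)"
    by (intro add_right_mono mult_left_mono Suc) simp
  also have "\<dots> = ennreal (?\<alpha>\<^sup>2 * (C / (real m + 1)) + ?\<beta>\<^sup>2 * C)"
    using C by (subst ennreal_plus) (simp_all add: ennreal_mult[symmetric])
  also have "?\<alpha>\<^sup>2 * (C / (real m + 1)) + ?\<beta>\<^sup>2 * C = C / (real (Suc m) + 1)"
  proof -
    have x: "real m + 1 > 0" "real m + 2 > 0" by auto
    have "(p / q)\<^sup>2 * (C / p) + (1 / q)\<^sup>2 * C = (p + 1) * C / (q * q)" if "p > 0" "q > 0" for p q :: real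
      using that by (simp add: power2_eq_square field_simps)
    from this[OF x] have "?\<alpha>\<^sup>2 * (C / (real m + 1)) + ?\<beta>\<^sup>2 * C
        = (real m + 2) * C / ((real m + 2) * (real m + 2))"
      unfolding \<beta> unfolding \<alpha> by (simp add: add.commute)
    also have "\<dots> = C / (real m + 2)" by simp
    finally show ?thesis by (simp add: add.commute)
  qed
  finally show ?case .
qed

lemma expected_error_A2_norm:
  assumes u: "u \<in> A2 \<rho> W b R"
  shows "integrable (\<Pi>\<^sub>M k\<in>{..<m}. \<rho>) (\<lambda>s. (energy_norm (u - iterate a R T u s m))\<^sup>2)"
    and "(\<integral>s. (energy_norm (u - iterate a R T u s m))\<^sup>2 \<partial>(\<Pi>\<^sub>M k\<in>{..<m}. \<rho>))
      \<le> (\<Lambda> * A2_norm \<rho> W b R u + energy_norm u)\<^sup>2 / (real m + 1)"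
proof -
  let ?P = "\<Pi>\<^sub>M k\<in>{..<m}. \<rho>" and ?f = "\<lambda>s. (energy_norm (u - iterate a R T u s m))\<^sup>2"
  let ?N = "\<lambda>v. sqrt (\<integral>\<omega>. (form_norm (b \<omega>) (v \<omega>))\<^sup>2 \<partial>\<rho>)"
  let ?S = "{?N v | v. A2_representation \<rho> W b R u v}"
  obtain v0 where v0: "A2_representation \<rho> W b R u v0" using u by (auto simp: A2_def)
  note iterate_measurable [measurable]
  have meas: "?f \<in> borel_measurable ?P" by measurable
  show int: "integrable ?P ?f"
    using expected_error[OF v0, of m] meas
    by (intro integrableI_nonneg) (auto simp: less_top[symmetric] top_unique)
  let ?E = "\<integral>s. ?f s \<partial>?P" and ?U = "energy_norm u"
  define x where "x = sqrt (?E * (real m + 1))"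
  have E: "0 \<le> ?E" by (intro integral_nonneg_AE) simp
  have x_le: "x \<le> \<Lambda> * ?N v + ?U" if v: "A2_representation \<rho> W b R u v" for v
  proof -
    have "ennreal ?E \<le> ennreal ((\<Lambda> * ?N v + ?U)\<^sup>2 / (real m + 1))"
      using expected_error[OF v, of m] nn_integral_eq_integral[OF int] by simp
    then have "?E \<le> (\<Lambda> * ?N v + ?U)\<^sup>2 / (real m + 1)" by (simp add: ennreal_le_iff)
    then have "?E * (real m + 1) \<le> (\<Lambda> * ?N v + ?U)\<^sup>2" by (simp add: pos_le_divide_eq)
    then show ?thesis
      unfolding x_def using \<Lambda>_nonneg by (intro real_le_lsqrt) auto
  qed
  have x_Inf: "x \<le> \<Lambda> * Inf ?S + ?U"
  proof (cases "\<Lambda> = 0")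
    case True
    then show ?thesis using x_le[OF v0] by simp
  next
    case False
    then have pos: "0 < \<Lambda>" using \<Lambda>_nonneg by simp
    have "(x - ?U) / \<Lambda> \<le> Inf ?S"
    proof (rule cInf_greatest)
      show "?S \<noteq> {}" using v0 by blast
      fix n assume "n \<in> ?S"
      then have "x \<le> \<Lambda> * n + ?U" using x_le by blast
      then show "(x - ?U) / \<Lambda> \<le> n" using pos by (simp add: field_simps)
    qed
    then show ?thesis using pos by (simp add: field_simps)
  qed
  have "?E * (real m + 1) = x\<^sup>2" using E by (simp add: x_def)
  also have "\<dots> \<le> (\<Lambda> * A2_norm \<rho> W b R u + ?U)\<^sup>2"
    using x_Inf E by (intro power_mono) (simp_all add: x_def A2_norm_def)
  finally show "?E \<le> (\<Lambda> * A2_norm \<rho> W b R u + ?U)\<^sup>2 / (real m + 1)"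
    by (simp add: pos_le_divide_eq)
qed

end

text \<open>
  A negative bound on all operator norms forces every local space to be trivial, and then the norm
  in \<open>A2\<close> vanishes.
\<close>

lemma A2_norm_trivial:
  assumes u: "u \<in> A2 \<rho> W b R"
    and trivial: "\<And>\<omega> x. \<omega> \<in> space \<rho> \<Longrightarrow> x \<in> W \<omega> \<Longrightarrow> x = 0"
    and b: "\<And>\<omega>. \<omega> \<in> space \<rho> \<Longrightarrow> b \<omega> 0 0 = 0"
  shows "A2_norm \<rho> W b R u = 0"
proof -
  have "sqrt (\<integral>\<omega>. (form_norm (b \<omega>) (v \<omega>))\<^sup>2 \<partial>\<rho>) = 0" if v: "A2_representation \<rho> W b R u v" for v
  proof -
    have "form_norm (b \<omega>) (v \<omega>) = 0" if "\<omega> \<in> space \<rho>" for \<omega>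
      using v that trivial[OF that, of "v \<omega>"] b[OF that]
      by (simp add: A2_representation_def form_norm_def)
    then have "(\<integral>\<omega>. (form_norm (b \<omega>) (v \<omega>))\<^sup>2 \<partial>\<rho>) = (\<integral>\<omega>. 0 \<partial>\<rho>)"
      by (intro Bochner_Integration.integral_cong) auto
    then show ?thesis by simp
  qed
  moreover obtain v where "A2_representation \<rho> W b R u v" using u by (auto simp: A2_def)
  ultimately have "{sqrt (\<integral>\<omega>. (form_norm (b \<omega>) (v \<omega>))\<^sup>2 \<partial>\<rho>) | v. A2_representation \<rho> W b R u v} = {0}"
    by force
  then show ?thesis by (simp add: A2_norm_def)
qed

section \<open>The convergence rate\<close>

theorem theorem1:
  fixes a :: "'v::{real_inner,banach,second_countable_topology} \<Rightarrow> 'v \<Rightarrow> real"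
    and F :: "'v \<Rightarrow> real"
    and u :: 'v
    and \<rho> :: "'i measure"
    and W :: "'i \<Rightarrow> 'w::real_vector set"
    and ip b :: "'i \<Rightarrow> 'w \<Rightarrow> 'w \<Rightarrow> real"
    and R :: "'i \<Rightarrow> 'w \<Rightarrow> 'v"
    and T :: "'i \<Rightarrow> 'v \<Rightarrow> 'w"
    and \<Lambda> :: real
    and m :: nat
  assumes a_continuous: "bounded_bilinear a"
    and a_symmetric: "\<And>v w. a v w = a w v"
    and a_coercive: "\<exists>c>0. \<forall>v. c * (norm v)\<^sup>2 \<le> a v v"
    and F_bounded_linear: "bounded_linear F"
    and u_solution: "\<And>v. a u v = F v"
    and rho_prob: "prob_space \<rho>"
    and W_hilbert: "\<And>\<omega>. \<omega> \<in> space \<rho> \<Longrightarrow> separable_hilbert_on (W \<omega>) (ip \<omega>)"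
    and b_scalar_product: "\<And>\<omega>. \<omega> \<in> space \<rho> \<Longrightarrow> scalar_product_on (W \<omega>) (b \<omega>)"
    and b_equivalent: "\<And>\<omega>. \<omega> \<in> space \<rho> \<Longrightarrow> spectrally_equivalent_on (W \<omega>) (ip \<omega>) (b \<omega>)"
    and R_linear: "\<And>\<omega>. \<omega> \<in> space \<rho> \<Longrightarrow> linear_on_subspace (W \<omega>) (R \<omega>)"
    and R_kernel: "\<And>\<omega>. \<omega> \<in> space \<rho> \<Longrightarrow> {x \<in> W \<omega>. R \<omega> x = 0} = {0}"
    and R_bounded: "\<And>\<omega>. \<omega> \<in> space \<rho> \<Longrightarrow> operator_norm_on (W \<omega>) (b \<omega>) a (R \<omega>) \<le> ereal \<Lambda>"
    and T_range: "\<And>\<omega> v. \<omega> \<in> space \<rho> \<Longrightarrow> T \<omega> v \<in> W \<omega>"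
    and T_adjoint: "\<And>\<omega> v x. \<omega> \<in> space \<rho> \<Longrightarrow> x \<in> W \<omega> \<Longrightarrow> b \<omega> (T \<omega> v) x = a v (R \<omega> x)"
    and direction_measurable: "\<And>e. normalized_direction a R T e \<in> borel_measurable \<rho>"
    and u_A2: "u \<in> A2 \<rho> W b R"
  shows "integrable (\<Pi>\<^sub>M k\<in>{..<m}. \<rho>) (\<lambda>s. (form_norm a (u - iterate a R T u s m))\<^sup>2) \<and>
    (\<integral>s. (form_norm a (u - iterate a R T u s m))\<^sup>2 \<partial>(\<Pi>\<^sub>M k\<in>{..<m}. \<rho>))
      \<le> (\<Lambda> * A2_norm \<rho> W b R u + form_norm a u)\<^sup>2 / (real m + 1)"
proof -
  interpret prob_space \<rho> by (rule rho_prob)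
  have W: "subspace (W \<omega>)" if "\<omega> \<in> space \<rho>" for \<omega>
    using W_hilbert[OF that] by (simp add: separable_hilbert_on_def)
  note a = coercive_scalar_product[OF a_continuous a_symmetric a_coercive]
  note bound = operator_norm_on_bound[OF W b_scalar_product a R_linear R_bounded]
  interpret random_splitting \<rho> a W b R T "max 0 \<Lambda>"
    by (intro random_splitting.intro random_splitting_axioms.intro rho_prob a_continuous a_symmetric
        a_coercive W b_scalar_product max.cobounded1 bound(1) T_range T_adjoint direction_measurable)
  have "max 0 \<Lambda> * A2_norm \<rho> W b R u = \<Lambda> * A2_norm \<rho> W b R u"
  proof (cases "\<Lambda> < 0")
    case True
    have "b \<omega> 0 0 = 0" if "\<omega> \<in> space \<rho>" for \<omega>
      using scalar_product_zero[OF W b_scalar_product] that subspace_0[OF W] by blast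
    then have "A2_norm \<rho> W b R u = 0"
      by (intro A2_norm_trivial[OF u_A2]) (use bound(2) True in blast)+
    then show ?thesis by simp
  next
    case False
    then show ?thesis by (simp add: max_def)
  qed
  then show ?thesis using expected_error_A2_norm[OF u_A2, of m] by (simp only: simp_thms)
qed

end
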